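(* Let $m\ge 2$ be an integer and let $\mathbf{k}=(k_0,k_1,k_2,\ldots)$ be a sequence of positive integers. Let $$B^{(\mathbf{k})}_m(q)=\sum_{n=0}^{\infty} b^{(\mathbf{k})}_m(n)\,q^n=\prod_{j=0}^{\infty}\left(1-q^{m^j}\right)^{-k_j}$$ be the generating function for the numbers $b^{(\mathbf{k})}_m(n)$ of $\mathbf{k}$-coloured $m$-ary partitions of $n$. If $m$ is relatively prime to $(k_0-1)!$ and to $k_j!$ for all $j\ge 1$, then $$B^{(\mathbf{k})}_m(q)\equiv\left(\sum_{\ell_0=0}^{m-1}\binom{k_0-1+\ell_0}{k_0-1}q^{\ell_0}\right)\prod_{j=1}^{\infty}\left(\sum_{\ell_j=0}^{m-1}\binom{k_j+\ell_j}{k_j}q^{\ell_j m^j}\right)\pmod m.$$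
   Context: An $m$-ary partition of a nonnegative integer $n$ is an integer partition of $n$ in which each part is a nonnegative integer power of the fixed integer $m\ge 2$. Given a sequence $\mathbf{k}=(k_0,k_1,\ldots)$ of positive integers, an $m$-ary partition is $\mathbf{k}$-coloured when there are $k_j$ colours for the part $m^j$, for each $j\ge 0$; that is, there are $k_j$ different kinds of parts of the same size $m^j$ (so a $\mathbf{k}$-coloured $m$-ary partition of $n$ is a finite multiset of pairs $(j,c)$ with $j\ge 0$, $1\le c\le k_j$, whose sizes $m^j$ sum to $n$). $b^{(\mathbf{k})}_m(n)$ denotes the number of $\mathbf{k}$-coloured $m$-ary partitions of $n$. Series are formal power series in $q$ with integer coefficients, and $\equiv \pmod m$ between two such series means that coefficients of equal powers of $q$ are congruent modulo $m$. *)

theory Defs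
  imports "HOL-Analysis.Analysis" "HOL-Library.Multiset" "HOL-Number_Theory.Cong"
begin

text \<open>
  A \<open>k\<close>-coloured \<open>m\<close>-ary partition is a finite multiset of pairs \<open>(j, c)\<close>, where such a pair stands
  for a part of size \<open>m ^ j\<close> in the colour \<open>c \<in> {1..k j}\<close>.
\<close>

definition coloured_mary_partitions :: "nat \<Rightarrow> (nat \<Rightarrow> nat) \<Rightarrow> nat \<Rightarrow> (nat \<times> nat) multiset set" where
  "coloured_mary_partitions m k n =
     {P. set_mset P \<subseteq> (SIGMA j:UNIV. {1..k j}) \<and> (\<Sum>(j, c)\<in>#P. m ^ j) = n}"

definition num_coloured_mary_partitions :: "nat \<Rightarrow> (nat \<Rightarrow> nat) \<Rightarrow> nat \<Rightarrow> nat" where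
  "num_coloured_mary_partitions m k n = card (coloured_mary_partitions m k n)"

definition coloured_mary_gf :: "nat \<Rightarrow> (nat \<Rightarrow> nat) \<Rightarrow> int fps" where
  "coloured_mary_gf m k = Abs_fps (\<lambda>n. int (num_coloured_mary_partitions m k n))"

text \<open>
  The ring \<open>int\<close> is not of class \<open>inverse\<close>, so \<open>inverse\<close> is not available on \<open>int fps\<close>.  The inverse
  of a series with constant coefficient 1 is obtained from the library's \<open>fps_right_inverse\<close>, whose
  second argument is the inverse of the constant coefficient.
\<close>

definition fps_unit_inverse :: "int fps \<Rightarrow> int fps" where
  "fps_unit_inverse F = fps_right_inverse F 1"

definition fps_cong :: "int fps \<Rightarrow> int fps \<Rightarrow> int \<Rightarrow> bool" where
  "fps_cong F G m \<longleftrightarrow> (\<forall>n. [fps_nth F n = fps_nth G n] (mod m))"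

end

theory Submission
  imports Defs
begin

unbundle no vec_syntax
unbundle fps_syntax

text \<open>
  Put \<open>x\<^sub>j = q ^ (m ^ j)\<close> and let \<open>T\<^sub>k(x)\<close> be the polynomial
  \<open>\<Sum>l<m. ((k + l) choose k) x ^ l\<close>.  Since \<open>(1 - x) T\<^bsub>k+1\<^esub>(x)\<close> differs from \<open>T\<^sub>k(x)\<close> only by
  a multiple of \<open>(k + m) choose (k + 1)\<close>, which \<open>m\<close> divides when it is coprime to \<open>(k + 1)!\<close>,
  one gets \<open>T\<^sub>k(x) (1 - x) ^ (k + 1) \<equiv> 1 - x ^ m\<close> modulo \<open>m\<close>.  As \<open>x\<^sub>j ^ m = x\<^bsub>j+1\<^esub>\<close>, the product of
  the first factors on the right telescopes to \<open>1 - x\<^bsub>N+1\<^esub>\<close> times the product of the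
  \<open>(1 - x\<^sub>j) ^ (- k\<^sub>j)\<close> for \<open>j \<le> N\<close>, and \<open>1 - x\<^bsub>N+1\<^esub>\<close> does not affect low coefficients.
\<close>

section \<open>Truncated binomial series modulo \<open>m\<close>\<close>

text \<open>Multiplying the binomial by \<open>fact (Suc k)\<close> gives the rising factorial m (m
  + 1) ... (m + k), which has \<open>m\<close> as a factor; coprimality then cancels the
  factorial.\<close>

lemma dvd_binomial_add_self:
  fixes m k :: nat
  assumes "coprime m (fact (Suc k))"
  shows "m dvd ((k + m) choose Suc k)"
proof (cases m)
  case (Suc n)
  have "(k + m) choose Suc k = Suc (k + n) choose Suc k"
    using Suc by simp
  moreover have "fact (Suc k) * (Suc (k + n) choose Suc k) * fact n = fact (Suc (k + n))"
    using binomial_fact_lemma[of "Suc k" "Suc (k + n)"] by (simp add: mult_ac)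
  moreover have "fact (Suc (k + n)) = pochhammer (Suc n) (Suc k) * fact n"
    using pochhammer_product'[of "1::nat" n "Suc k"]
    by (simp add: pochhammer_fact mult.commute add.commute)
  ultimately have "fact (Suc k) * ((k + m) choose Suc k) = pochhammer m (Suc k)"
    using Suc by (metis fact_nonzero mult_right_cancel)
  moreover have "m dvd pochhammer m (Suc k)"
    by (simp add: pochhammer_rec)
  ultimately have "m dvd fact (Suc k) * ((k + m) choose Suc k)"
    by simp
  with assms show ?thesis
    using coprime_dvd_mult_right_iff by blast
qed (use assms in auto)

text \<open>Multiplication by \<open>1 - x\<close> takes differences of neighbouring coefficients,
  and Pascal's rule lowers \<open>Suc k\<close> to \<open>k\<close>. The last term is the boundary
  contribution of cutting the sum off at \<open>m\<close>.\<close>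

lemma sum_binomial_mult_one_minus:
  fixes x :: "'a::comm_ring_1"
  shows "(\<Sum>l<m. of_nat ((Suc k + l) choose Suc k) * x ^ l) * (1 - x) =
    (\<Sum>l<m. of_nat ((k + l) choose k) * x ^ l) - of_nat ((k + m) choose Suc k) * x ^ m"
proof (induction m)
  case (Suc m)
  have "(\<Sum>l<Suc m. of_nat ((Suc k + l) choose Suc k) * x ^ l) * (1 - x) =
      (\<Sum>l<m. of_nat ((Suc k + l) choose Suc k) * x ^ l) * (1 - x) +
      of_nat ((Suc k + m) choose Suc k) * x ^ m * (1 - x)"
    by (simp only: sum.lessThan_Suc distrib_right)
  also have "\<dots> = (\<Sum>l<m. of_nat ((k + l) choose k) * x ^ l) +
      (of_nat ((Suc k + m) choose Suc k) - of_nat ((k + m) choose Suc k)) * x ^ m -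
      of_nat ((k + Suc m) choose Suc k) * x ^ Suc m"
    unfolding Suc.IH by (simp only: add_Suc add_Suc_right) (simp add: algebra_simps)
  also have "of_nat ((Suc k + m) choose Suc k) - of_nat ((k + m) choose Suc k) =
      (of_nat ((k + m) choose k) :: 'a)"
    by simp
  finally show ?case
    by simp
qed (simp add: binomial_eq_0)

text \<open>The geometric sum starts the induction on \<open>k\<close>; each further factor
  \<open>1 - x\<close> lowers the series by one step, at the cost of a boundary term divisible by
  \<open>m\<close>. The general ring element \<open>x\<close> is later taken to be a power
  \<open>fps_X ^ (m ^ j)\<close>.\<close>

lemma truncated_binomial_series_cong:
  fixes x :: "'a::comm_ring_1"
  assumes "coprime m (fact k :: nat)"
  shows "of_nat m dvd (\<Sum>l<m. of_nat ((k + l) choose k) * x ^ l) * (1 - x) ^ Suc k - (1 - x ^ m)"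
  using assms
proof (induction k)
  case 0
  have "(\<Sum>l<m. x ^ l) * (1 - x) = 1 - x ^ m"
    by (simp add: one_diff_power_eq mult.commute)
  then show ?case
    by simp
next
  case (Suc k)
  define S where "S = (\<Sum>l<m. of_nat ((k + l) choose k) * x ^ l)"
  define b where "b = (k + m) choose Suc k"
  have "coprime m (fact k :: nat)"
    using Suc.prems by (simp only: fact_Suc of_nat_id coprime_mult_right_iff)
  then have IH: "of_nat m dvd S * (1 - x) ^ Suc k - (1 - x ^ m)"
    unfolding S_def by (rule Suc.IH)
  obtain c where "b = m * c"
    using dvd_binomial_add_self[OF Suc.prems] unfolding b_def by blast
  then have "(of_nat m :: 'a) dvd of_nat b"
    by simp
  then have "of_nat m dvd of_nat b * (x ^ m * (1 - x) ^ Suc k)"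
    by (rule dvd_mult2)
  with IH have "of_nat m dvd
      S * (1 - x) ^ Suc k - (1 - x ^ m) - of_nat b * (x ^ m * (1 - x) ^ Suc k)"
    by (rule dvd_diff)
  also have "\<dots> = (S - of_nat b * x ^ m) * (1 - x) ^ Suc k - (1 - x ^ m)"
    by (simp add: algebra_simps)
  also have "S - of_nat b * x ^ m =
      (\<Sum>l<m. of_nat ((Suc k + l) choose Suc k) * x ^ l) * (1 - x)"
    unfolding S_def b_def by (rule sum_binomial_mult_one_minus[symmetric])
  finally show ?case
    by (simp only: power_Suc mult.assoc)
qed

section \<open>Generating functions of weighted multisets\<close>

text \<open>Abstract elements with weights, instead of pairs of exponent and colour, allow induction
  over a finite set of part kinds, one kind at a time.\<close>

definition weighted_multisets :: "'a set \<Rightarrow> ('a \<Rightarrow> nat) \<Rightarrow> nat \<Rightarrow> 'a multiset set" where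
  "weighted_multisets A w n = {P. set_mset P \<subseteq> A \<and> (\<Sum>a\<in>#P. w a) = n}"

definition weighted_multisets_gf :: "'a set \<Rightarrow> ('a \<Rightarrow> nat) \<Rightarrow> int fps" where
  "weighted_multisets_gf A w = Abs_fps (\<lambda>n. int (card (weighted_multisets A w n)))"

lemma member_le_sum_mset:
  fixes w :: "'a \<Rightarrow> nat"
  assumes "a \<in># P"
  shows "w a \<le> (\<Sum>a\<in>#P. w a)"
proof -
  from assms obtain Q where "P = add_mset a Q"
    by (blast dest: multi_member_split)
  then show ?thesis
    by simp
qed

lemma size_le_sum_mset:
  fixes w :: "'a \<Rightarrow> nat"
  assumes "\<And>a. a \<in># P \<Longrightarrow> w a > 0"
  shows "size P \<le> (\<Sum>a\<in>#P. w a)"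
  using assms
proof (induction P)
  case (add a P)
  then have "size P \<le> (\<Sum>a\<in>#P. w a)" and "w a > 0"
    by auto
  then show ?case
    by simp
qed simp

text \<open>Positive weights bound the size of the multiset by \<open>n\<close>. Finiteness matters
  because \<open>card\<close> of an infinite set would be 0.\<close>

lemma finite_weighted_multisets:
  assumes "finite A" and "\<And>a. a \<in> A \<Longrightarrow> w a > 0"
  shows "finite (weighted_multisets A w n)"
proof (rule finite_subset)
  show "weighted_multisets A w n \<subseteq> (\<Union>s\<le>n. multisets_of_size A s)"
  proof
    fix P assume P: "P \<in> weighted_multisets A w n"
    then have "size P \<le> n"
      using size_le_sum_mset[of P w] assms(2) by (auto simp: weighted_multisets_def)
    with P show "P \<in> (\<Union>s\<le>n. multisets_of_size A s)"
      by (auto simp: weighted_multisets_def multisets_of_size_def)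
  qed
  show "finite (\<Union>s\<le>n. multisets_of_size A s)"
    using assms(1) by blast
qed

text \<open>Case split on whether \<open>a\<close> occurs; if so, one copy is removed and further
  copies may remain, so \<open>insert a A\<close> reappears on the right. The test
  \<open>w a \<le> n\<close> guards against truncated subtraction.\<close>

lemma weighted_multisets_insert:
  "weighted_multisets (insert a A) w n = weighted_multisets A w n \<union>
    (if w a \<le> n then add_mset a ` weighted_multisets (insert a A) w (n - w a) else {})"
    (is "?L = ?R")
proof (intro equalityI subsetI)
  fix P assume P: "P \<in> ?L"
  show "P \<in> ?R"
  proof (cases "a \<in># P")
    case True
    then obtain Q where Q: "P = add_mset a Q"
      by (blast dest: multi_member_split)
    with P have "w a \<le> n" "Q \<in> weighted_multisets (insert a A) w (n - w a)"
      by (auto simp: weighted_multisets_def)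
    with Q show ?thesis
      by auto
  next
    case False
    with P show ?thesis
      by (auto simp: weighted_multisets_def)
  qed
qed (auto simp: weighted_multisets_def split: if_splits)

lemma weighted_multisets_gf_insert:
  assumes "finite A" and "a \<notin> A" and "\<And>b. b \<in> insert a A \<Longrightarrow> w b > 0"
  shows "(1 - fps_X ^ w a) * weighted_multisets_gf (insert a A) w = weighted_multisets_gf A w"
proof (rule fps_ext)
  fix n
  let ?W = "weighted_multisets"
  have fin: "finite (?W A w i)" "finite (?W (insert a A) w i)" for i
    using assms(1) assms(3) finite_weighted_multisets[of A w] finite_weighted_multisets[of "insert a A" w]
    by blast+
  have "card (?W (insert a A) w n) = card (?W A w n) +
      (if w a \<le> n then card (?W (insert a A) w (n - w a)) else 0)"
  proof (cases "w a \<le> n")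
    case True
    have "?W A w n \<inter> add_mset a ` ?W (insert a A) w (n - w a) = {}"
    proof -
      have "a \<notin># P" if "P \<in> ?W A w n" for P
        using that assms(2) unfolding weighted_multisets_def by blast
      then show ?thesis
        by fastforce
    qed
    then have "card (?W A w n \<union> add_mset a ` ?W (insert a A) w (n - w a)) =
        card (?W A w n) + card (add_mset a ` ?W (insert a A) w (n - w a))"
      by (intro card_Un_disjoint) (use fin in auto)
    with True show ?thesis
      by (subst weighted_multisets_insert) (simp add: card_image inj_on_def)
  next
    case False
    then show ?thesis
      by (subst weighted_multisets_insert) simp
  qed
  then show "((1 - fps_X ^ w a) * weighted_multisets_gf (insert a A) w) $ n =
      weighted_multisets_gf A w $ n"
    by (auto simp: weighted_multisets_gf_def left_diff_distrib fps_X_power_mult_nth)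
qed

text \<open>The finite Euler product in denominator-free form, so that no inverse series enters the
  induction.\<close>

lemma prod_mult_weighted_multisets_gf:
  assumes "finite A" and "\<And>a. a \<in> A \<Longrightarrow> w a > 0"
  shows "(\<Prod>a\<in>A. 1 - fps_X ^ w a) * weighted_multisets_gf A w = 1"
  using assms
proof (induction A rule: finite_induct)
  case empty
  have "weighted_multisets {} w n = (if n = 0 then {{#}} else {})" for n
    by (auto simp: weighted_multisets_def)
  then show ?case
    by (intro fps_ext) (simp add: weighted_multisets_gf_def)
next
  case (insert a A)
  have "(\<Prod>b\<in>insert a A. 1 - fps_X ^ w b) * weighted_multisets_gf (insert a A) w =
      (\<Prod>b\<in>A. 1 - fps_X ^ w b) * ((1 - fps_X ^ w a) * weighted_multisets_gf (insert a A) w)"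
    using insert.hyps by (simp add: mult_ac)
  also have "\<dots> = (\<Prod>b\<in>A. 1 - fps_X ^ w b) * weighted_multisets_gf A w"
    using insert.hyps insert.prems by (subst weighted_multisets_gf_insert) auto
  also have "\<dots> = 1"
    using insert.IH insert.prems by simp
  finally show ?case .
qed

section \<open>The product formula for coloured partitions\<close>

text \<open>Bounding the exponents by \<open>N\<close> leaves finitely many kinds of parts; the
  resulting series turns out to be the \<open>N\<close>-th partial product of the full generating
  function.\<close>

definition bounded_mary_gf :: "nat \<Rightarrow> (nat \<Rightarrow> nat) \<Rightarrow> nat \<Rightarrow> int fps" where
  "bounded_mary_gf m k N =
     weighted_multisets_gf (SIGMA j:{..N}. {1..k j}) (\<lambda>(j, c). m ^ j)"

lemma prod_mult_bounded_mary_gf: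
  assumes "m > 0"
  shows "(\<Prod>j\<le>N. (1 - fps_X ^ (m ^ j)) ^ k j) * bounded_mary_gf m k N = 1"
proof -
  let ?w = "\<lambda>(j, c). m ^ j"
  have "(\<Prod>a\<in>(SIGMA j:{..N}. {1..k j}). 1 - fps_X ^ ?w a) * bounded_mary_gf m k N = 1"
    unfolding bounded_mary_gf_def
    by (rule prod_mult_weighted_multisets_gf) (use assms in auto)
  moreover have "(\<Prod>a\<in>(SIGMA j:{..N}. {1..k j}). 1 - fps_X ^ ?w a) =
      (\<Prod>j\<le>N. (1 - fps_X ^ (m ^ j)) ^ k j :: int fps)"
  proof -
    have "(\<Prod>a\<in>(SIGMA j:{..N}. {1..k j}). 1 - fps_X ^ ?w a) =
        (\<Prod>j\<le>N. \<Prod>c\<in>{1..k j}. 1 - fps_X ^ (m ^ j) :: int fps)"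
      by (subst prod.Sigma) (auto intro!: prod.cong)
    then show ?thesis
      by simp
  qed
  ultimately show ?thesis
    by simp
qed

text \<open>A part \<open>m ^ j\<close> in a partition of \<open>n\<close> satisfies
  \<open>j < m ^ j \<le> n \<le> N\<close>, so the bound on exponents excludes nothing.\<close>

lemma coloured_mary_gf_nth:
  assumes "m \<ge> 2" and "n \<le> N"
  shows "coloured_mary_gf m k $ n = bounded_mary_gf m k N $ n"
proof -
  let ?w = "\<lambda>(j, c). m ^ j"
  have bound: "j \<le> N" if "(j, c) \<in># P" and "(\<Sum>a\<in>#P. ?w a) = n" for P :: "(nat \<times> nat) multiset" and j c
  proof -
    have "m ^ j \<le> n"
      using member_le_sum_mset[OF that(1), of ?w] that(2) by simp
    moreover have "j < m ^ j"
      using assms(1) by (intro power_gt_expt) simp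
    ultimately show ?thesis
      using assms(2) by simp
  qed
  have "set_mset P \<subseteq> (SIGMA j:UNIV. {1..k j}) \<longleftrightarrow> set_mset P \<subseteq> (SIGMA j:{..N}. {1..k j})"
    if "(\<Sum>a\<in>#P. ?w a) = n" for P
    using bound[OF _ that] by blast
  then have "coloured_mary_partitions m k n =
      weighted_multisets (SIGMA j:{..N}. {1..k j}) ?w n"
    unfolding coloured_mary_partitions_def weighted_multisets_def by (intro Collect_cong) blast
  then show ?thesis
    by (simp add: coloured_mary_gf_def num_coloured_mary_partitions_def bounded_mary_gf_def
        weighted_multisets_gf_def)
qed

lemma mult_fps_unit_inverse:
  assumes "F $ 0 = 1"
  shows "F * fps_unit_inverse F = 1"
  unfolding fps_unit_inverse_def using assms by (simp add: fps_right_inverse)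

text \<open>The partial products and \<open>bounded_mary_gf\<close> are inverse to the same finite
  product, hence equal, and their coefficients stabilise.\<close>

lemma has_prod_coloured_mary_gf:
  assumes "m \<ge> 2"
  shows "(\<lambda>j. fps_unit_inverse (1 - fps_X ^ (m ^ j)) ^ k j) has_prod coloured_mary_gf m k"
proof -
  let ?E = "\<lambda>j. fps_unit_inverse (1 - fps_X ^ (m ^ j)) ^ k j"
  have partial: "(\<Prod>j\<le>N. ?E j) = bounded_mary_gf m k N" for N
  proof -
    let ?D = "\<Prod>j\<le>N. (1 - fps_X ^ (m ^ j)) ^ k j :: int fps"
    have "(1 - fps_X ^ (m ^ j)) ^ k j * ?E j = 1" for j
      using assms
      by (subst power_mult_distrib[symmetric], subst mult_fps_unit_inverse) auto
    then have DE: "?D * (\<Prod>j\<le>N. ?E j) = 1"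
      by (subst prod.distrib[symmetric]) simp
    have DG: "?D * bounded_mary_gf m k N = 1"
      using assms by (intro prod_mult_bounded_mary_gf) simp
    have "(\<Prod>j\<le>N. ?E j) = (\<Prod>j\<le>N. ?E j) * (?D * bounded_mary_gf m k N)"
      unfolding DG by (rule mult_1_right[symmetric])
    also have "\<dots> = ?D * (\<Prod>j\<le>N. ?E j) * bounded_mary_gf m k N"
      by (simp only: mult_ac)
    also have "\<dots> = bounded_mary_gf m k N"
      unfolding DE by (rule mult_1)
    finally show ?thesis .
  qed
  have "(\<lambda>N. \<Prod>j\<le>N. ?E j) \<longlonglongrightarrow> coloured_mary_gf m k"
    unfolding partial
    by (rule tendsto_fpsI, rule eventually_sequentiallyI) (rule coloured_mary_gf_nth[OF assms, symmetric])
  \<comment> \<open>\<open>raw_has_prod\<close> demands a nonzero limit; a vanishing constant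
    coefficient would contradict the product formula for \<open>N = 0\<close>.\<close>
  moreover have "coloured_mary_gf m k \<noteq> 0"
  proof
    assume "coloured_mary_gf m k = 0"
    then have "bounded_mary_gf m k 0 $ 0 = 0"
      using coloured_mary_gf_nth[OF assms, of 0 0 k] by simp
    then have "((\<Prod>j\<le>0. (1 - fps_X ^ (m ^ j)) ^ k j) * bounded_mary_gf m k 0) $ 0 = 0"
      by simp
    moreover have "(\<Prod>j\<le>0. (1 - fps_X ^ (m ^ j)) ^ k j) * bounded_mary_gf m k 0 = 1"
      using assms by (intro prod_mult_bounded_mary_gf) simp
    ultimately show False
      by (simp only: fps_one_nth) simp
  qed
  ultimately show ?thesis
    by (simp add: has_prod_def raw_has_prod_def)
qed

section \<open>Infinite products of formal power series\<close>

lemma fps_mult_nth_eq_left: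
  fixes f g :: "'a::comm_semiring_1 fps"
  assumes "\<And>j. j \<le> n \<Longrightarrow> g $ j = 1 $ j"
  shows "(f * g) $ n = f $ n"
proof -
  have "(f * g) $ n = (f * 1) $ n"
    unfolding fps_mult_nth using assms by (intro sum.cong) auto
  then show ?thesis
    by simp
qed

lemma fps_prod_nth_stable:
  fixes f :: "nat \<Rightarrow> 'a::comm_semiring_1 fps"
  assumes "\<And>i j. j \<le> i \<Longrightarrow> f i $ j = 1 $ j" and "n \<le> N"
  shows "(\<Prod>i\<le>N. f i) $ n = (\<Prod>i\<le>n. f i) $ n"
  using assms(2)
proof (induction N rule: dec_induct)
  case (step N)
  then show ?case
    by (simp add: assms(1) fps_mult_nth_eq_left)
qed simp

text \<open>The factor \<open>f i\<close> is 1 through degree \<open>i\<close>, so coefficient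
  \<open>n\<close> no longer changes after the factors 0 to \<open>n\<close>. The limit is therefore
  the diagonal series, with constant coefficient 1.\<close>

lemma fps_has_prod:
  fixes f :: "nat \<Rightarrow> 'a::idom fps"
  assumes f: "\<And>i j. j \<le> i \<Longrightarrow> f i $ j = 1 $ j"
  shows "f has_prod Abs_fps (\<lambda>n. (\<Prod>i\<le>n. f i) $ n)"
proof -
  have "(\<lambda>N. \<Prod>i\<le>N. f i) \<longlonglongrightarrow> Abs_fps (\<lambda>n. (\<Prod>i\<le>n. f i) $ n)"
    by (rule tendsto_fpsI, rule eventually_sequentiallyI) (simp only: fps_nth_Abs_fps, rule fps_prod_nth_stable[OF f])
  moreover have "Abs_fps (\<lambda>n. (\<Prod>i\<le>n. f i) $ n) $ 0 \<noteq> 0"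
    by (simp add: f)
  then have "Abs_fps (\<lambda>n. (\<Prod>i\<le>n. f i) $ n) \<noteq> 0"
    by (auto simp only: fps_zero_nth)
  ultimately show ?thesis
    by (simp add: has_prod_def raw_has_prod_def)
qed

section \<open>Telescoping and the final congruence\<close>

text \<open>In the application \<open>d j\<close> is \<open>1 - fps_X ^ (m ^ j)\<close> and
  \<open>D j\<close> its \<open>k j\<close>-th power. The conditional makes the telescope start from
  1 instead of \<open>d 0\<close>, matching the binomials with \<open>k 0 - 1\<close> in the first
  factor.\<close>

lemma telescoping_cong:
  fixes d T D :: "nat \<Rightarrow> 'a::comm_ring_1"
  assumes "\<And>j. a dvd T j * D j * (if j = 0 then 1 else d j) - d (Suc j)"
  shows "a dvd (\<Prod>j\<le>N. T j) * (\<Prod>j\<le>N. D j) - d (Suc N)"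
proof (induction N)
  case 0
  then show ?case
    using assms[of 0] by simp
next
  case (Suc N)
  define P where "P = (\<Prod>j\<le>N. T j) * (\<Prod>j\<le>N. D j)"
  have "a dvd (P - d (Suc N)) * (T (Suc N) * D (Suc N)) +
      (T (Suc N) * D (Suc N) * d (Suc N) - d (Suc (Suc N)))"
    using Suc.IH assms[of "Suc N"] by (intro dvd_add dvd_mult2) (auto simp: P_def)
  also have "\<dots> = P * (T (Suc N) * D (Suc N)) - d (Suc (Suc N))"
    by (simp add: algebra_simps)
  finally show ?case
    by (simp add: P_def mult_ac)
qed

theorem theorem2p1:
  fixes m :: nat and k :: "nat \<Rightarrow> nat"
  assumes m_ge_2: "m \<ge> 2"
    and k_pos: "\<And>j. k j > 0"
    and coprime_0: "coprime m (fact (k 0 - 1))"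
    and coprime_j: "\<And>j. j \<ge> 1 \<Longrightarrow> coprime m (fact (k j))"
  shows "(\<lambda>j. fps_unit_inverse (1 - fps_X ^ (m ^ j)) ^ k j) has_prod coloured_mary_gf m k
    \<and> convergent_prod (\<lambda>i. \<Sum>l<m. of_nat ((k (Suc i) + l) choose k (Suc i)) * (fps_X :: int fps) ^ (l * m ^ Suc i))
    \<and> fps_cong (coloured_mary_gf m k)
        ((\<Sum>l<m. of_nat ((k 0 - 1 + l) choose (k 0 - 1)) * fps_X ^ l) *
         (\<Prod>i. \<Sum>l<m. of_nat ((k (Suc i) + l) choose k (Suc i)) * fps_X ^ (l * m ^ Suc i)))
        (int m)"
proof (intro conjI)
  show "(\<lambda>j. fps_unit_inverse (1 - fps_X ^ (m ^ j)) ^ k j) has_prod coloured_mary_gf m k"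
    using m_ge_2 by (rule has_prod_coloured_mary_gf)

  let ?f = "\<lambda>i. \<Sum>l<m. of_nat ((k (Suc i) + l) choose k (Suc i)) * (fps_X :: int fps) ^ (l * m ^ Suc i)"
  let ?T0 = "\<Sum>l<m. of_nat ((k 0 - 1 + l) choose (k 0 - 1)) * (fps_X :: int fps) ^ l"
  have less: "j < m ^ j" for j
    using m_ge_2 by (intro power_gt_expt) simp
  have coeff: "?f i $ j = 1 $ j" if "j \<le> i" for i j
  proof -
    \<comment> \<open>The term for \<open>l = 0\<close> is 1; every other term has degree at least
      \<open>m ^ Suc i\<close>, which exceeds \<open>j\<close>.\<close>
    have "?f i = 1 + (\<Sum>l\<in>{1..<m}. of_nat ((k (Suc i) + l) choose k (Suc i)) * fps_X ^ (l * m ^ Suc i))"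
      using m_ge_2 by (simp add: lessThan_atLeast0 sum.atLeast_Suc_lessThan)
    moreover have "j < l * m ^ Suc i" if "l \<in> {1..<m}" for l
    proof -
      have "j < m ^ Suc i"
        using \<open>j \<le> i\<close> less[of "Suc i"] by simp
      also have "\<dots> \<le> l * m ^ Suc i"
        using that by simp
      finally show ?thesis .
    qed
    then have "(\<Sum>l\<in>{1..<m}. of_nat ((k (Suc i) + l) choose k (Suc i)) *
        (fps_X :: int fps) ^ (l * m ^ Suc i)) $ j = 0"
      unfolding fps_sum_nth by (intro sum.neutral) (auto simp: fps_X_power_mult_right_nth)
    ultimately show ?thesis
      by simp
  qed
  have prod: "?f has_prod Abs_fps (\<lambda>n. (\<Prod>i\<le>n. ?f i) $ n)"
    by (rule fps_has_prod) (rule coeff)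
  then show "convergent_prod ?f"
    unfolding has_prod_def convergent_prod_def by blast

  show "fps_cong (coloured_mary_gf m k) (?T0 * (\<Prod>i. ?f i)) (int m)"
    unfolding fps_cong_def
  proof
    fix n
    define T where "T j = (case j of 0 \<Rightarrow> ?T0 | Suc i \<Rightarrow> ?f i)" for j
    define d where "d j = (1 - fps_X ^ (m ^ j) :: int fps)" for j
    define G where "G = bounded_mary_gf m k n"
    have "of_nat m dvd T j * d j ^ k j * (if j = 0 then 1 else d j) - d (Suc j)" for j
    proof (cases j)
      case 0
      have "Suc (k 0 - 1) = k 0"
        using k_pos[of 0] by simp
      then show ?thesis
        using truncated_binomial_series_cong[OF coprime_0, of "fps_X :: int fps"] 0
        by (simp add: T_def d_def)
    next
      case (Suc i)
      have "coprime m (fact (k (Suc i)))"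
        by (rule coprime_j) simp
      from truncated_binomial_series_cong[OF this, of "fps_X ^ (m ^ Suc i) :: int fps"] Suc
      show ?thesis
        by (simp add: T_def d_def mult_ac flip: power_mult)
    qed
    then have "of_nat m dvd (\<Prod>j\<le>n. T j) * (\<Prod>j\<le>n. d j ^ k j) - d (Suc n)"
      by (rule telescoping_cong)
    \<comment> \<open>\<open>G\<close> is the inverse of the product of the
      \<open>d j ^ k j\<close>, so this leaves the product of the \<open>T j\<close> congruent to
      \<open>G * d (Suc n)\<close>.\<close>
    then have "of_nat m dvd ((\<Prod>j\<le>n. T j) * (\<Prod>j\<le>n. d j ^ k j) - d (Suc n)) * G"
      by (rule dvd_mult2)
    also have "\<dots> = (\<Prod>j\<le>n. T j) * ((\<Prod>j\<le>n. d j ^ k j) * G) - G * d (Suc n)"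
      by (simp add: algebra_simps)
    also have "(\<Prod>j\<le>n. d j ^ k j) * G = 1"
      unfolding d_def G_def using m_ge_2 by (intro prod_mult_bounded_mary_gf) simp
    finally obtain H where "(\<Prod>j\<le>n. T j) * 1 - G * d (Suc n) = of_nat m * H"
      by (elim dvdE)
    then have "int m dvd ((\<Prod>j\<le>n. T j) * 1 - G * d (Suc n)) $ n"
      by (simp del: fps_sub_nth)
    moreover have "(G * d (Suc n)) $ n = coloured_mary_gf m k $ n"
    proof -
      have "(G * d (Suc n)) $ n = G $ n"
        using less[of "Suc n"]
        by (intro fps_mult_nth_eq_left) (auto simp: d_def fps_X_power_nth)
      then show ?thesis
        using coloured_mary_gf_nth[OF m_ge_2, of n n k] by (simp add: G_def)
    qed
    moreover have "(\<Prod>j\<le>n. T j) $ n = (?T0 * (\<Prod>i. ?f i)) $ n"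
    proof -
      \<comment> \<open>The extra factor \<open>T (Suc n)\<close> is \<open>?f n\<close>, equal to 1
        through degree \<open>n\<close>; after splitting off \<open>T 0\<close> the shifted product
        runs exactly over \<open>i \<le> n\<close>.\<close>
      have "(\<Prod>j\<le>n. T j) $ n = (\<Prod>j\<le>Suc n. T j) $ n"
        using coeff[of _ n] by (simp add: T_def fps_mult_nth_eq_left)
      also have "\<dots> = (?T0 * (\<Prod>i\<le>n. ?f i)) $ n"
        by (subst prod.atMost_Suc_shift) (simp add: T_def)
      also have "\<dots> = (?T0 * (\<Prod>i. ?f i)) $ n"
      proof -
        have "(\<Prod>i\<le>n. ?f i) $ j = (\<Prod>i. ?f i) $ j" if "j \<le> n" for j
          unfolding has_prod_unique[OF prod, symmetric] fps_nth_Abs_fps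
          using coeff that by (rule fps_prod_nth_stable)
        then show ?thesis
          unfolding fps_mult_nth by (intro sum.cong) auto
      qed
      finally show ?thesis .
    qed
    ultimately show "[coloured_mary_gf m k $ n = (?T0 * (\<Prod>i. ?f i)) $ n] (mod int m)"
      by (simp add: cong_iff_dvd_diff dvd_diff_commute)
  qed
qed

end
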